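(* For every deterministic online algorithm with predictions for interval selection with unit weights in the model of irrevocable decisions, there exist an instance with unit weights (with an arrival order and a fixed optimal solution) and predictions, with total error $\eta$, such that $ALG = OPT - \eta$.
   Context: Interval selection: an instance is a finite nonempty set $\mathcal{I}$ of intervals $[s_i,f_i)$ on the real line, $s_i<f_i$, arriving one at a time in an arbitrary (adversarial) order. Two intervals conflict if they intersect. Each interval $I$ has a weight $w(I)$; unit weights means $w(I)=1$ for all $I$. The goal is to output a set of pairwise disjoint intervals of maximum total weight. $OPT$ denotes the maximum total weight of a set of pairwise disjoint intervals of the instance, and $ALG$ the total weight of the algorithm's final solution. Irrevocable decisions: upon each arrival, the algorithm, knowing only the intervals and predictions revealed so far, must accept or reject the interval; both decisions are final, and the accepted intervals must be pairwise disjoint. Predictions: each interval $I$ arrives together with a bit $Prd(I)\in\{0,1\}$; $Prd(I)=1$ means $I$ is predicted to belong to a fixed optimal solution $O$, and $Prd(I)=0$ means it is predicted not to belong to $O$. The prediction of $I$ is accurate if ($Prd(I)=1 \iff I\in O$). Error (with respect to $O$): $\eta(I)=0$ if the prediction of $I$ is accurate; $\eta(I)=w(I)$ if $I\in O$ and $Prd(I)=0$; $\eta(I)=\sum_{J\in\mathcal{C}}w(J)-w(I)$ if $I\notin O$ and $Prd(I)=1$, where $\mathcal{C}$ is the set of intervals of $O$ that conflict with $I$. The total error is $\eta=\sum_{I\in\mathcal{I}}\eta(I)$. *)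

theory Defs
  imports Complex_Main
begin

text \<open>
  The pair \<open>(s, f)\<close> encodes the half-open interval \<open>[s, f)\<close>. Nonempty intervals are determined by
  their end points, so a set of intervals is a set of such pairs with \<open>s < f\<close>.
\<close>
type_synonym interval = "real \<times> real"

definition points :: "interval \<Rightarrow> real set" where
  "points I = {fst I..<snd I}"

definition conflict :: "interval \<Rightarrow> interval \<Rightarrow> bool" where
  "conflict I J \<longleftrightarrow> points I \<inter> points J \<noteq> {}"

definition disjoint_intervals :: "interval set \<Rightarrow> bool" where
  "disjoint_intervals S \<longleftrightarrow> pairwise (\<lambda>I J. \<not> conflict I J) S"

text \<open>
  An instance is listed in its order of arrival; as a set of intervals it is \<open>set arr\<close>.
\<close>
definition is_instance :: "interval list \<Rightarrow> bool" where
  "is_instance arr \<longleftrightarrow> arr \<noteq> [] \<and> distinct arr \<and> (\<forall>I\<in>set arr. fst I < snd I)"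

type_synonym weight = "interval \<Rightarrow> real"

definition unit_weight :: weight where
  "unit_weight = (\<lambda>I. 1)"

definition OPT :: "weight \<Rightarrow> interval set \<Rightarrow> real" where
  "OPT w X = Max {sum w S |S. S \<subseteq> X \<and> disjoint_intervals S}"

definition optimal_solution :: "weight \<Rightarrow> interval set \<Rightarrow> interval set \<Rightarrow> bool" where
  "optimal_solution w X Opt \<longleftrightarrow> Opt \<subseteq> X \<and> disjoint_intervals Opt \<and> sum w Opt = OPT w X"

type_synonym prediction = "interval \<Rightarrow> bool"

definition accurate :: "prediction \<Rightarrow> interval set \<Rightarrow> interval \<Rightarrow> bool" where
  "accurate prd Opt I \<longleftrightarrow> (prd I \<longleftrightarrow> I \<in> Opt)"

definition interval_error :: "weight \<Rightarrow> prediction \<Rightarrow> interval set \<Rightarrow> interval \<Rightarrow> real" where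
  "interval_error w prd Opt I =
     (if accurate prd Opt I then 0
      else if I \<in> Opt then w I
      else sum w {J \<in> Opt. conflict J I} - w I)"

definition total_error :: "weight \<Rightarrow> prediction \<Rightarrow> interval set \<Rightarrow> interval set \<Rightarrow> real" where
  "total_error w prd Opt X = (\<Sum>I\<in>X. interval_error w prd Opt I)"

text \<open>
  A deterministic online algorithm decides on the current interval from the previously revealed
  intervals with their predictions (first argument, in order of arrival) and from the current
  interval with its prediction (second argument); \<open>True\<close> means accept. Its own earlier decisions
  are a function of the first argument. Weights are not an input, so the type models algorithms
  for instances whose weights are known beforehand, such as unit weights.
\<close>
type_synonym online_algorithm = "(interval \<times> bool) list \<Rightarrow> interval \<times> bool \<Rightarrow> bool"

definition revealed :: "prediction \<Rightarrow> interval list \<Rightarrow> (interval \<times> bool) list" where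
  "revealed prd arr = map (\<lambda>I. (I, prd I)) arr"

definition accepted :: "online_algorithm \<Rightarrow> prediction \<Rightarrow> interval list \<Rightarrow> interval set" where
  "accepted A prd arr =
     {arr ! i |i. i < length arr \<and> A (revealed prd (take i arr)) (arr ! i, prd (arr ! i))}"

text \<open>
  Decisions are final, so the final solution consists of all intervals ever accepted. It has to be
  feasible on every instance and for all predictions, accurate or not.
\<close>
definition irrevocable_algorithm :: "online_algorithm \<Rightarrow> bool" where
  "irrevocable_algorithm A \<longleftrightarrow>
     (\<forall>arr prd. is_instance arr \<longrightarrow> disjoint_intervals (accepted A prd arr))"

definition ALG :: "weight \<Rightarrow> online_algorithm \<Rightarrow> prediction \<Rightarrow> interval list \<Rightarrow> real" where
  "ALG w A prd arr = sum w (accepted A prd arr)"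

end

theory Submission
  imports Defs
begin

text \<open>
  The adversary first presents \<open>[0, 2)\<close> with prediction 0. If it is rejected, the instance ends:
  the lost interval is paid for by its own wrong prediction. If it is accepted, the two halves
  arrive with predictions 1 and 0; the algorithm is stuck with one interval, the optimum
  is 2, and only the second half is mispredicted.
\<close>

text \<open>Two half-open intervals that meet share the larger of their left end points. Both
  inequalities are strict, so the touching halves \<open>(0, 1)\<close> and \<open>(1, 2)\<close> do
  not conflict.\<close>

lemma conflict_iff:
  assumes "fst I < snd I" "fst J < snd J"
  shows "conflict I J \<longleftrightarrow> fst I < snd J \<and> fst J < snd I"
proof -
  have "max (fst I) (fst J) \<in> points I \<inter> points J" if "fst I < snd J" "fst J < snd I"
    using that assms by (auto simp: points_def)
  then show ?thesis
    by (auto simp: conflict_def points_def)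
qed

text \<open>Unit weights turn sums into cardinalities, so a witness \<open>S\<close> of largest
  cardinality attains the maximum.\<close>

lemma OPT_unit_weight_eq:
  assumes "finite X" "S \<subseteq> X" "disjoint_intervals S"
    and "\<And>T. T \<subseteq> X \<Longrightarrow> disjoint_intervals T \<Longrightarrow> card T \<le> card S"
  shows "OPT unit_weight X = card S"
  unfolding OPT_def
proof (rule Max_eqI)
  show "finite {sum unit_weight S |S. S \<subseteq> X \<and> disjoint_intervals S}"
    using assms(1) by simp
qed (use assms in \<open>auto simp: unit_weight_def\<close>)

theorem theorem3p3:
  fixes A :: online_algorithm
  assumes "irrevocable_algorithm A"
  shows "\<exists>(arr :: interval list) (Opt :: interval set) (prd :: prediction).
           is_instance arr \<and>
           optimal_solution unit_weight (set arr) Opt \<and>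
           ALG unit_weight A prd arr =
             OPT unit_weight (set arr) - total_error unit_weight prd Opt (set arr)"
proof (cases "A [] ((0, 2), False)")
  case False
  let ?I = "(0, 2) :: interval"
  let ?prd = "(\<lambda>_. False) :: prediction"
  have "is_instance [?I]"
    by (simp add: is_instance_def)
  moreover have opt: "OPT unit_weight {?I} = 1"
    using OPT_unit_weight_eq[of "{?I}" "{?I}"] card_mono[of "{?I}"]
    by (simp add: disjoint_intervals_def)
  moreover have "optimal_solution unit_weight {?I} {?I}"
    using opt by (simp add: optimal_solution_def disjoint_intervals_def unit_weight_def)
  moreover have "accepted A ?prd [?I] = {}"
    using False by (simp add: accepted_def revealed_def)
  then have "ALG unit_weight A ?prd [?I] = 0"
    by (simp add: ALG_def)
  moreover have "total_error unit_weight ?prd {?I} {?I} = 1"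
    by (simp add: total_error_def interval_error_def accurate_def unit_weight_def)
  ultimately show ?thesis
    by (intro exI[of _ "[?I]"] exI[of _ "{?I}"] exI[of _ ?prd]) simp
next
  case True
  let ?I = "(0, 2) :: interval" and ?J = "(0, 1) :: interval" and ?K = "(1, 2) :: interval"
  let ?arr = "[?I, ?J, ?K]" and ?Opt = "{?J, ?K}"
  \<comment> \<open>On \<open>?I\<close> this agrees with the other case, so \<open>A\<close> faces
    the same first query. The only wrong bit is the one of \<open>?K\<close>, which costs 1.\<close>
  let ?prd = "(\<lambda>L. L = ?J) :: prediction"
  have inst: "is_instance ?arr"
    by (simp add: is_instance_def)
  have disj: "disjoint_intervals ?Opt"
    by (simp add: disjoint_intervals_def pairwise_insert conflict_iff)
  \<comment> \<open>Used twice: to bound the optimum and to determine what \<open>A\<close>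
    accepts.\<close>
  have only_I: "S = {?I}" if "S \<subseteq> set ?arr" "disjoint_intervals S" "?I \<in> S" for S
  proof -
    have "\<not> conflict ?I L" if "L \<in> S" "L \<noteq> ?I" for L
      using that \<open>disjoint_intervals S\<close> \<open>?I \<in> S\<close>
      by (auto simp: disjoint_intervals_def pairwise_def)
    moreover have "conflict ?I ?J" "conflict ?I ?K"
      by (simp_all add: conflict_iff)
    ultimately show ?thesis
      using that by auto
  qed
  have opt: "OPT unit_weight (set ?arr) = 2"
  proof -
    have "card S \<le> card ?Opt" if "S \<subseteq> set ?arr" "disjoint_intervals S" for S
    proof (cases "?I \<in> S")
      case True
      then show ?thesis
        using only_I[OF that] by simp
    next
      case False
      with that have "S \<subseteq> ?Opt"
        by auto
      then show ?thesis
        by (intro card_mono) auto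
    qed
    then show ?thesis
      using OPT_unit_weight_eq[of "set ?arr" ?Opt] disj by simp
  qed
  have "optimal_solution unit_weight (set ?arr) ?Opt"
    using opt disj by (auto simp: optimal_solution_def unit_weight_def)
  \<comment> \<open>Feasibility forces the rejection of both halves once \<open>?I\<close> has been
    accepted.\<close>
  moreover have "accepted A ?prd ?arr = {?I}"
  proof (rule only_I)
    show "accepted A ?prd ?arr \<subseteq> set ?arr"
      unfolding accepted_def using nth_mem by blast
    show "disjoint_intervals (accepted A ?prd ?arr)"
      using assms inst by (simp add: irrevocable_algorithm_def)
    show "?I \<in> accepted A ?prd ?arr"
      \<comment> \<open>At index 0 the history is empty, so the query is the one of the case
        distinction.\<close>
      using True by (auto simp: accepted_def revealed_def intro: exI[of _ 0])
  qed
  then have "ALG unit_weight A ?prd ?arr = 1"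
    by (simp add: ALG_def unit_weight_def)
  moreover have "total_error unit_weight ?prd ?Opt (set ?arr) = 1"
    by (simp add: total_error_def interval_error_def accurate_def unit_weight_def)
  ultimately show ?thesis
    using inst opt
    by (intro exI[of _ ?arr] exI[of _ ?Opt] exI[of _ ?prd]) simp
qed

end
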